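(* Let $\mathbb{K}$ be a field of characteristic zero and let $\mathcal{D}\subset\mathbb{Z}_+^3$ be a three-dimensional Ferrers diagram. Then the Ferrers ideal $I_{\mathcal{D}}=(x_iy_jz_k:(i,j,k)\in\mathcal{D})\subset R=\mathbb{K}[x_1,\dots,x_m,y_1,\dots,y_n,z_1,\dots,z_p]$ satisfies the $\ell$-exchange property with respect to any monomial order $<$ on $\mathbb{K}[\mathbf{T}]$.
   Context: A three-dimensional Ferrers diagram is a finite nonempty set $\mathcal{D}\subset\mathbb{Z}_+^3$ ($\mathbb{Z}_+$ the positive integers) such that whenever $(i_0,j_0,k_0)\in\mathcal{D}$ and $i\le i_0$, $j\le j_0$, $k\le k_0$ are positive integers, then $(i,j,k)\in\mathcal{D}$. Here $m,n,p$ are the maximal first, second, third coordinates of points of $\mathcal{D}$. $\ell$-exchange property: let $I=(f_1,\dots,f_M)\subset\mathbb{K}[w_1,\dots,w_N]$ be a monomial ideal generated in one degree (with $f_1,\dots,f_M$ its monomial generators), let $\mathbb{K}[\mathbf{T}]=\mathbb{K}[T_1,\dots,T_M]$, and let $J$ be the kernel of the surjection $\psi:\mathbb{K}[\mathbf{T}]\to\mathbb{K}[f_1,\dots,f_M]$, $\psi(T_i)=f_i$. Let $<$ be a monomial order on $\mathbb{K}[\mathbf{T}]$. A monomial of $\mathbb{K}[\mathbf{T}]$ is standard (for $J$ and $<$) if it does not belong to the initial ideal of $J$. The ideal $I$ satisfies the $\ell$-exchange property with respect to $<$ if the following holds: whenever $\mathbf{T}^{\boldsymbol a}$ and $\mathbf{T}^{\boldsymbol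 b}$ are standard monomials of $J$ of the same degree with $u=\psi(\mathbf{T}^{\boldsymbol a})$, $v=\psi(\mathbf{T}^{\boldsymbol b})$ satisfying (i) $\deg_{w_t}(u)=\deg_{w_t}(v)$ for $t=1,\dots,q-1$ with $q\le N-1$, and (ii) $\deg_{w_q}(u)<\deg_{w_q}(v)$, there exist an integer $k$ and an integer $q<j\le N$ such that $w_qf_k/w_j\in I$. For $I_{\mathcal{D}}$ the variables $w_1,\dots,w_N$ are $x_1,\dots,x_m,y_1,\dots,y_n,z_1,\dots,z_p$ in this order and the generators are the monomials $x_iy_jz_k$, $(i,j,k)\in\mathcal{D}$. *)

theory Defs
  imports "HOL-Library.Poly_Mapping" "HOL-Algebra.RingHom"
begin

text \<open>
  A monomial in variables of type \<open>'v\<close> is given by its exponent vector, a finitely supported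
  function; a polynomial is a finitely supported function on monomials.  Multiplication of
  monomials is thus written as addition of exponent vectors.
\<close>

type_synonym 'v monom = "'v \<Rightarrow>\<^sub>0 nat"
type_synonym ('v, 'k) mpoly = "'v monom \<Rightarrow>\<^sub>0 'k"

definition monoms :: "'v set \<Rightarrow> 'v monom set"
  where "monoms V = {t. Poly_Mapping.keys t \<subseteq> V}"

definition monom_deg :: "'v monom \<Rightarrow> nat"
  where "monom_deg t = (\<Sum>v\<in>Poly_Mapping.keys t. Poly_Mapping.lookup t v)"

definition mono_poly :: "'v monom \<Rightarrow> ('v, 'k::field) mpoly"
  where "mono_poly t = Poly_Mapping.single t 1"

definition var :: "'v \<Rightarrow> ('v, 'k::field) mpoly"
  where "var v = mono_poly (Poly_Mapping.single v 1)"

definition deg_in :: "'v \<Rightarrow> ('v, 'k::field) mpoly \<Rightarrow> nat"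
  where "deg_in v p = Max (insert 0 ((\<lambda>t. Poly_Mapping.lookup t v) ` Poly_Mapping.keys p))"

text \<open>The polynomial ring \<open>K[V]\<close> in the variables belonging to the set \<open>V\<close>.\<close>

definition poly_ring :: "'v set \<Rightarrow> ('v, 'k::field) mpoly ring"
  where "poly_ring V =
    \<lparr>carrier = {p. Poly_Mapping.keys p \<subseteq> monoms V}, mult = (*), one = 1, zero = 0, add = (+)\<rparr>"

text \<open>
  The relation contains \<open>(s, t)\<close> iff \<open>s \<le> t\<close>.  On finitely many variables, being a well-order
  follows from the conditions given here.
\<close>

definition monomial_order :: "'v set \<Rightarrow> 'v monom rel \<Rightarrow> bool"
  where "monomial_order V ord \<longleftrightarrow>
    linear_order_on (monoms V) ord \<and>
    (\<forall>t\<in>monoms V. (0, t) \<in> ord) \<and>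
    (\<forall>s t. (s, t) \<in> ord \<longrightarrow> (\<forall>u\<in>monoms V. (s + u, t + u) \<in> ord))"

definition lead_monom :: "'v monom rel \<Rightarrow> ('v, 'k::field) mpoly \<Rightarrow> 'v monom"
  where "lead_monom ord p =
    (THE t. t \<in> Poly_Mapping.keys p \<and> (\<forall>s\<in>Poly_Mapping.keys p. (s, t) \<in> ord))"

definition initial_ideal ::
    "'v set \<Rightarrow> 'v monom rel \<Rightarrow> ('v, 'k::field) mpoly set \<Rightarrow> ('v, 'k) mpoly set"
  where "initial_ideal V ord J =
    genideal (poly_ring V) {mono_poly (lead_monom ord g) | g. g \<in> J \<and> g \<noteq> 0}"

definition standard_monom ::
    "'v set \<Rightarrow> 'v monom rel \<Rightarrow> ('v, 'k::field) mpoly set \<Rightarrow> 'v monom \<Rightarrow> bool"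
  where "standard_monom V ord J t \<longleftrightarrow>
    t \<in> monoms V \<and> (mono_poly t :: ('v, 'k) mpoly) \<notin> initial_ideal V ord J"

text \<open>
  Generators \<open>f i\<close> are indexed by a set \<open>A\<close>, which also indexes the variables \<open>T\<^sub>i\<close>.
  The map \<open>psi f\<close> is the \<open>K\<close>-algebra homomorphism sending \<open>T\<^sub>i\<close> to \<open>f i\<close>.
\<close>

definition psi :: "('i \<Rightarrow> ('v, 'k::field) mpoly) \<Rightarrow> ('i, 'k) mpoly \<Rightarrow> ('v, 'k) mpoly"
  where "psi f p =
    (\<Sum>t\<in>Poly_Mapping.keys p. Poly_Mapping.single 0 (Poly_Mapping.lookup p t) *
      (\<Prod>i\<in>Poly_Mapping.keys t. f i ^ Poly_Mapping.lookup t i))"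

text \<open>
  The codomain here is \<open>K[w\<^sub>1,\<dots>,w\<^sub>N]\<close> rather than its subalgebra generated by the \<open>f i\<close>;
  this does not affect the kernel.
\<close>

definition toric_ideal ::
    "nat \<Rightarrow> 'i set \<Rightarrow> ('i \<Rightarrow> (nat, 'k::field) mpoly) \<Rightarrow> ('i, 'k) mpoly set"
  where "toric_ideal N A f = a_kernel (poly_ring A) (poly_ring {1..N}) (psi f)"

definition equigenerated :: "nat \<Rightarrow> 'i set \<Rightarrow> ('i \<Rightarrow> (nat, 'k::field) mpoly) \<Rightarrow> bool"
  where "equigenerated N A f \<longleftrightarrow>
    finite A \<and> (\<exists>d. \<forall>i\<in>A. \<exists>t\<in>monoms {1..N}. f i = mono_poly t \<and> monom_deg t = d)"

text \<open>
  The variables \<open>w\<^sub>1,\<dots>,w\<^sub>N\<close> are the numbers \<open>1,\<dots>,N\<close>.  The notion is meant for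
  \<open>equigenerated N A f\<close>.  That \<open>w\<^sub>q f\<^sub>k / w\<^sub>j\<close> lies in the ideal means that the quotient exists
  in the polynomial ring (where it is unique) and belongs to the ideal.
\<close>

definition l_exchange ::
    "nat \<Rightarrow> 'i set \<Rightarrow> ('i \<Rightarrow> (nat, 'k::field) mpoly) \<Rightarrow> 'i monom rel \<Rightarrow> bool"
  where "l_exchange N A f ord \<longleftrightarrow>
    (\<forall>a b q.
      standard_monom A ord (toric_ideal N A f) a \<longrightarrow>
      standard_monom A ord (toric_ideal N A f) b \<longrightarrow>
      monom_deg a = monom_deg b \<longrightarrow>
      1 \<le> q \<longrightarrow> q \<le> N - 1 \<longrightarrow>
      (\<forall>t\<in>{1..q - 1}. deg_in t (psi f (mono_poly a)) = deg_in t (psi f (mono_poly b))) \<longrightarrow>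
      deg_in q (psi f (mono_poly a)) < deg_in q (psi f (mono_poly b)) \<longrightarrow>
      (\<exists>k\<in>A. \<exists>j. q < j \<and> j \<le> N \<and>
        (\<exists>g\<in>genideal (poly_ring {1..N}) (f ` A). var j * g = var q * f k)))"

definition ferrers_diagram :: "(nat \<times> nat \<times> nat) set \<Rightarrow> bool"
  where "ferrers_diagram D \<longleftrightarrow>
    finite D \<and> D \<noteq> {} \<and> D \<subseteq> {1..} \<times> {1..} \<times> {1..} \<and>
    (\<forall>i0 j0 k0. (i0, j0, k0) \<in> D \<longrightarrow>
      (\<forall>i\<in>{1..i0}. \<forall>j\<in>{1..j0}. \<forall>k\<in>{1..k0}. (i, j, k) \<in> D))"

definition max1 :: "(nat \<times> nat \<times> nat) set \<Rightarrow> nat"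
  where "max1 D = Max ((\<lambda>(i, j, k). i) ` D)"

definition max2 :: "(nat \<times> nat \<times> nat) set \<Rightarrow> nat"
  where "max2 D = Max ((\<lambda>(i, j, k). j) ` D)"

definition max3 :: "(nat \<times> nat \<times> nat) set \<Rightarrow> nat"
  where "max3 D = Max ((\<lambda>(i, j, k). k) ` D)"

text \<open>
  With \<open>m\<close>, \<open>n\<close>, \<open>p\<close> the three maxima, \<open>x\<^sub>i\<close>, \<open>y\<^sub>j\<close>, \<open>z\<^sub>k\<close> are the variables number
  \<open>i\<close>, \<open>m + j\<close>, \<open>m + n + k\<close> among \<open>m + n + p\<close>.
\<close>

definition ferrers_gen ::
    "(nat \<times> nat \<times> nat) set \<Rightarrow> nat \<times> nat \<times> nat \<Rightarrow> (nat, 'k::field) mpoly"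
  where "ferrers_gen D = (\<lambda>(i, j, k). var i * var (max1 D + j) * var (max1 D + max2 D + k))"

lemma cring_poly_ring: "cring (poly_ring V :: ('v, 'k::field) mpoly ring)"
proof -
  have mult: "Poly_Mapping.keys (p * q) \<subseteq> monoms V"
    if "Poly_Mapping.keys p \<subseteq> monoms V" "Poly_Mapping.keys q \<subseteq> monoms V"
    for p q :: "('v, 'k) mpoly"
  proof
    fix t assume "t \<in> Poly_Mapping.keys (p * q)"
    then obtain r s where "t = r + s" "r \<in> Poly_Mapping.keys p" "s \<in> Poly_Mapping.keys q"
      using keys_mult[of p q] by blast
    with that show "t \<in> monoms V"
      using Poly_Mapping.keys_add[of r s] unfolding monoms_def by blast
  qed
  have add: "Poly_Mapping.keys (p + q) \<subseteq> monoms V"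
    if "Poly_Mapping.keys p \<subseteq> monoms V" "Poly_Mapping.keys q \<subseteq> monoms V"
    for p q :: "('v, 'k) mpoly"
    using that Poly_Mapping.keys_add[of p q] by blast
  have one: "Poly_Mapping.keys (1 :: ('v, 'k) mpoly) \<subseteq> monoms V"
    by (simp add: monoms_def)
  have neg: "Poly_Mapping.keys (- p) \<subseteq> monoms V"
    if "Poly_Mapping.keys p \<subseteq> monoms V" for p :: "('v, 'k) mpoly"
    using that by (auto simp: in_keys_iff subset_iff)
  show ?thesis
  proof (rule cringI)
    show "abelian_group (poly_ring V :: ('v, 'k) mpoly ring)"
    proof (rule abelian_groupI)
      fix p :: "('v, 'k) mpoly" assume "p \<in> carrier (poly_ring V)"
      then show "\<exists>q\<in>carrier (poly_ring V). q \<oplus>\<^bsub>poly_ring V\<^esub> p = \<zero>\<^bsub>poly_ring V\<^esub>"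
        using neg[of p] by (intro bexI[of _ "- p"]) (auto simp: poly_ring_def)
    qed (use add in \<open>auto simp: poly_ring_def add_ac\<close>)
    show "Group.comm_monoid (poly_ring V :: ('v, 'k) mpoly ring)"
      by unfold_locales (use mult one in \<open>auto simp: poly_ring_def mult_ac\<close>)
  qed (auto simp: poly_ring_def algebra_simps)
qed

lemma equigenerated_ferrers_gen:
  assumes "ferrers_diagram D"
  shows "equigenerated (max1 D + max2 D + max3 D) D (ferrers_gen D)"
proof -
  have fin: "finite D" and pos: "D \<subseteq> {1..} \<times> {1..} \<times> {1..}"
    using assms by (auto simp: ferrers_diagram_def)
  have "\<exists>t\<in>monoms {1..max1 D + max2 D + max3 D}.
          ferrers_gen D e = mono_poly t \<and> monom_deg t = 3" if e: "e \<in> D" for e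
  proof -
    obtain i j k where ijk: "e = (i, j, k)" by (cases e)
    have i: "1 \<le> i" "i \<le> max1 D" and j: "1 \<le> j" "j \<le> max2 D" and k: "1 \<le> k" "k \<le> max3 D"
      using e pos fin unfolding ijk max1_def max2_def max3_def
      by (force intro!: Max_ge)+
    define t :: "nat monom" where "t = Poly_Mapping.single i 1 +
      Poly_Mapping.single (max1 D + j) 1 + Poly_Mapping.single (max1 D + max2 D + k) 1"
    have t_keys: "Poly_Mapping.keys t = {i, max1 D + j, max1 D + max2 D + k}"
      unfolding t_def using i j k by (auto simp: in_keys_iff lookup_add lookup_single when_def split: if_splits)
    have "monom_deg t = 3"
      unfolding monom_deg_def t_keys using i j k
      by (simp add: t_def lookup_add lookup_single when_def)
    moreover have "t \<in> monoms {1..max1 D + max2 D + max3 D}"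
      using t_keys i j k by (auto simp: monoms_def)
    moreover have "ferrers_gen D e = mono_poly t"
      by (simp add: ferrers_gen_def ijk var_def mono_poly_def mult_single t_def)
    ultimately show ?thesis by blast
  qed
  with fin show ?thesis unfolding equigenerated_def by blast
qed

end

theory Submission
  imports Defs
begin

text \<open>
  Write \<open>w\<^sub>1,\<dots>,w\<^sub>N\<close> for the variables \<open>x\<^sub>1,\<dots>,x\<^sub>m,y\<^sub>1,\<dots>,y\<^sub>n,z\<^sub>1,\<dots>,z\<^sub>p\<close>.  There are two situations.

  If \<open>w\<^sub>q\<close> is not the last variable of its block, the exchange takes place inside the block.  When
  \<open>q < m\<close>, for instance, \<open>x\<^bsub>q+1\<^esub>y\<^sub>1z\<^sub>1\<close> is a generator, because \<open>D\<close> contains a point with first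
  coordinate \<open>m\<close> and is closed under decreasing coordinates; replacing \<open>x\<^bsub>q+1\<^esub>\<close> by \<open>x\<^sub>q\<close> gives
  \<open>x\<^sub>qy\<^sub>1z\<^sub>1\<close>, which is again a generator (\<open>ferrers_exchange\<close>).

  If \<open>w\<^sub>q\<close> is the last variable of the \<open>x\<close>- or of the \<open>y\<close>-block, no exchange with a later variable
  can stay in the ideal, so conditions (i) and (ii) must be contradictory.  They are: every generator
  has degree one in each block, hence the degree of \<open>\<psi>(T\<^sup>a)\<close> in each block is the degree of
  \<open>T\<^sup>a\<close> (\<open>block_degree_psi\<close>).  Monomials \<open>u\<close> and \<open>v\<close> coming from the same degree therefore have
  equal degree in the block of \<open>w\<^sub>q\<close>, and if they agree in all variables before \<open>w\<^sub>q\<close>, they also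
  agree in \<open>w\<^sub>q\<close>.
\<close>

lemma deg_in_mono_poly:
  "deg_in v (mono_poly t :: ('v, 'k::field) mpoly) = Poly_Mapping.lookup t v"
  by (simp add: deg_in_def mono_poly_def)

lemma mono_poly_add:
  "(mono_poly (s + t) :: ('v, 'k::field) mpoly) = mono_poly s * mono_poly t"
  by (simp add: mono_poly_def mult_single)

lemma mono_poly_sum:
  "(mono_poly (\<Sum>i\<in>A. e i) :: ('v, 'k::field) mpoly) = (\<Prod>i\<in>A. mono_poly (e i))"
  by (induction A rule: infinite_finite_induct) (simp_all add: mono_poly_add, simp_all add: mono_poly_def)

lemma psi_mono_poly:
  "psi f (mono_poly t) = (\<Prod>i\<in>Poly_Mapping.keys t. f i ^ Poly_Mapping.lookup t i)"
  by (simp add: psi_def mono_poly_def)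

lemma deg_in_psi_mono_poly:
  fixes f :: "'i \<Rightarrow> ('v, 'k::field) mpoly"
  assumes f: "\<And>i. i \<in> A \<Longrightarrow> f i = mono_poly (e i)" and a: "a \<in> monoms A"
  shows "deg_in v (psi f (mono_poly a)) =
    (\<Sum>i\<in>Poly_Mapping.keys a. Poly_Mapping.lookup a i * Poly_Mapping.lookup (e i) v)"
proof -
  (* The inner sum of the constant e i is the exponent vector of a power of f i. *)
  have "psi f (mono_poly a) =
      mono_poly (\<Sum>i\<in>Poly_Mapping.keys a. \<Sum>l<Poly_Mapping.lookup a i. e i)"
    unfolding psi_mono_poly mono_poly_sum
    by (rule prod.cong) (use f a in \<open>auto simp: monoms_def\<close>)
  then show ?thesis
    by (simp add: deg_in_mono_poly lookup_sum)
qed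

text \<open>
  Each factor \<open>T\<^sub>i\<close> of \<open>T\<^sup>a\<close> contributes exactly one variable from the block \<open>B\<close> to \<open>\<psi>(T\<^sup>a)\<close>.
\<close>

lemma block_degree_psi:
  fixes f :: "'i \<Rightarrow> ('v, 'k::field) mpoly"
  assumes f: "\<And>i. i \<in> A \<Longrightarrow> f i = mono_poly (e i)"
    and one: "\<And>i. i \<in> A \<Longrightarrow> (\<Sum>v\<in>B. Poly_Mapping.lookup (e i) v) = 1"
    and a: "a \<in> monoms A"
  shows "(\<Sum>v\<in>B. deg_in v (psi f (mono_poly a))) = monom_deg a"
proof -
  have "(\<Sum>v\<in>B. deg_in v (psi f (mono_poly a))) =
      (\<Sum>i\<in>Poly_Mapping.keys a. \<Sum>v\<in>B. Poly_Mapping.lookup a i * Poly_Mapping.lookup (e i) v)"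
    using deg_in_psi_mono_poly[of A f e a] f a by (simp add: sum.swap[of _ B])
  also have "\<dots> = (\<Sum>i\<in>Poly_Mapping.keys a. Poly_Mapping.lookup a i)"
    by (rule sum.cong) (use one a in \<open>auto simp: monoms_def simp flip: sum_distrib_left\<close>)
  finally show ?thesis by (simp add: monom_deg_def)
qed

text \<open>
  Conditions (i) and (ii) of the \<open>\<ell>\<close>-exchange property exclude each other when \<open>w\<^sub>q\<close> is the last
  variable of a block in which all generators have degree one: the degree in the whole block is
  prescribed, so the degrees in the other variables of the block determine the one in \<open>w\<^sub>q\<close>.
\<close>

lemma deg_in_last_of_block:
  fixes f :: "'i \<Rightarrow> (nat, 'k::field) mpoly"
  assumes f: "\<And>i. i \<in> A \<Longrightarrow> f i = mono_poly (e i)"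
    and one: "\<And>i. i \<in> A \<Longrightarrow> (\<Sum>v=r..q. Poly_Mapping.lookup (e i) v) = 1"
    and a: "a \<in> monoms A" and b: "b \<in> monoms A" and deg: "monom_deg a = monom_deg b"
    and rq: "1 \<le> r" "r \<le> q"
    and eq: "\<forall>t\<in>{1..q - 1}. deg_in t (psi f (mono_poly a)) = deg_in t (psi f (mono_poly b))"
  shows "deg_in q (psi f (mono_poly a)) = deg_in q (psi f (mono_poly b))"
proof -
  have block: "{r..q} = insert q {r..<q}"
    using rq by auto
  have "(\<Sum>v=r..q. deg_in v (psi f (mono_poly a))) = (\<Sum>v=r..q. deg_in v (psi f (mono_poly b)))"
    using block_degree_psi[of A f e "{r..q}", OF f one] a b deg by simp
  moreover have "(\<Sum>v=r..<q. deg_in v (psi f (mono_poly a))) =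
      (\<Sum>v=r..<q. deg_in v (psi f (mono_poly b)))"
    by (rule sum.cong) (use eq rq in auto)
  ultimately show ?thesis
    unfolding block by simp
qed

definition ferrers_exp :: "(nat \<times> nat \<times> nat) set \<Rightarrow> nat \<times> nat \<times> nat \<Rightarrow> nat monom"
  where "ferrers_exp D = (\<lambda>(i, j, k). Poly_Mapping.single i 1 +
    Poly_Mapping.single (max1 D + j) 1 + Poly_Mapping.single (max1 D + max2 D + k) 1)"

lemma ferrers_gen_eq_mono_poly:
  "(ferrers_gen D c :: (nat, 'k::field) mpoly) = mono_poly (ferrers_exp D c)"
  by (cases c) (simp add: ferrers_gen_def ferrers_exp_def var_def mono_poly_add)

lemma ferrers_diagram_bounds:
  assumes "ferrers_diagram D" "(i, j, k) \<in> D"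
  shows "1 \<le> i" "i \<le> max1 D" "1 \<le> j" "j \<le> max2 D" "1 \<le> k" "k \<le> max3 D"
proof -
  have fin: "finite D" and "D \<subseteq> {1..} \<times> {1..} \<times> {1..}"
    using assms(1) by (auto simp: ferrers_diagram_def)
  then show "1 \<le> i" "1 \<le> j" "1 \<le> k"
    using assms(2) by auto
  show "i \<le> max1 D" "j \<le> max2 D" "k \<le> max3 D"
    unfolding max1_def max2_def max3_def
    by (rule Max_ge; use fin assms(2) in force)+
qed

lemma sum_lookup_single:
  "finite B \<Longrightarrow>
    (\<Sum>v\<in>B. Poly_Mapping.lookup (Poly_Mapping.single u n) v) = (if u \<in> B then n else 0)"
  by (simp add: lookup_single when_def)

lemma ferrers_exp_x_degree:
  assumes "ferrers_diagram D" "c \<in> D"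
  shows "(\<Sum>v=1..max1 D. Poly_Mapping.lookup (ferrers_exp D c) v) = 1"
proof (cases c)
  case (fields i j k)
  show ?thesis
    using ferrers_diagram_bounds[of D i j k] assms unfolding fields
    by (simp add: ferrers_exp_def lookup_add sum.distrib sum_lookup_single)
qed

lemma ferrers_exp_y_degree:
  assumes "ferrers_diagram D" "c \<in> D"
  shows "(\<Sum>v=max1 D + 1..max1 D + max2 D. Poly_Mapping.lookup (ferrers_exp D c) v) = 1"
proof (cases c)
  case (fields i j k)
  show ?thesis
    using ferrers_diagram_bounds[of D i j k] assms unfolding fields
    by (simp add: ferrers_exp_def lookup_add sum.distrib sum_lookup_single)
qed

text \<open>
  Some point of \<open>D\<close> attains the maximum of the given coordinate, and the points claimed to lie in
  \<open>D\<close> are coordinatewise below it.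
\<close>

lemma ferrers_diagram_axes:
  assumes "ferrers_diagram D"
  shows "\<And>i. 1 \<le> i \<Longrightarrow> i \<le> max1 D \<Longrightarrow> (i, 1, 1) \<in> D"
    and "\<And>j. 1 \<le> j \<Longrightarrow> j \<le> max2 D \<Longrightarrow> (1, j, 1) \<in> D"
    and "\<And>k. 1 \<le> k \<Longrightarrow> k \<le> max3 D \<Longrightarrow> (1, 1, k) \<in> D"
proof -
  have D: "finite D" "D \<noteq> {}"
    and down: "\<And>i0 j0 k0 i j k. (i0, j0, k0) \<in> D \<Longrightarrow> i \<in> {1..i0} \<Longrightarrow> j \<in> {1..j0} \<Longrightarrow>
      k \<in> {1..k0} \<Longrightarrow> (i, j, k) \<in> D"
    using assms unfolding ferrers_diagram_def by blast+
  have "max1 D \<in> (\<lambda>(i, j, k). i) ` D"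
    unfolding max1_def by (rule Max_in) (use D in auto)
  then obtain j1 k1 where "(max1 D, j1, k1) \<in> D" by auto
  with ferrers_diagram_bounds[OF assms this]
  show "(i, 1, 1) \<in> D" if "1 \<le> i" "i \<le> max1 D" for i
    using that by (auto intro: down)
  have "max2 D \<in> (\<lambda>(i, j, k). j) ` D"
    unfolding max2_def by (rule Max_in) (use D in auto)
  then obtain i2 k2 where "(i2, max2 D, k2) \<in> D" by auto
  with ferrers_diagram_bounds[OF assms this]
  show "(1, j, 1) \<in> D" if "1 \<le> j" "j \<le> max2 D" for j
    using that by (auto intro: down)
  have "max3 D \<in> (\<lambda>(i, j, k). k) ` D"
    unfolding max3_def by (rule Max_in) (use D in auto)
  then obtain i3 j3 where "(i3, j3, max3 D) \<in> D" by auto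
  with ferrers_diagram_bounds[OF assms this]
  show "(1, 1, k) \<in> D" if "1 \<le> k" "k \<le> max3 D" for k
    using that by (auto intro: down)
qed

lemma ferrers_gen_in_ideal:
  fixes D :: "(nat \<times> nat \<times> nat) set"
  defines "N \<equiv> max1 D + max2 D + max3 D"
  assumes D: "ferrers_diagram D" and c: "c \<in> D"
  shows "(ferrers_gen D c :: (nat, 'k::field) mpoly) \<in>
    genideal (poly_ring {1..N}) (ferrers_gen D ` D)"
proof -
  interpret cring "poly_ring {1..N} :: (nat, 'k) mpoly ring"
    by (rule cring_poly_ring)
  have "ferrers_gen D ` D \<subseteq> carrier (poly_ring {1..N} :: (nat, 'k) mpoly ring)"
    using equigenerated_ferrers_gen[OF D, where 'a = 'k]
    by (auto simp: equigenerated_def poly_ring_def mono_poly_def N_def)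
  then show ?thesis
    using genideal_self c by blast
qed

text \<open>
  Since \<open>w\<^sub>q\<close> does not end its block, \<open>w\<^bsub>q+1\<^esub>\<close> lies in the same block, and on the corresponding
  coordinate axis \<open>D\<close> has a point for each of the two.  The generators of these two points differ
  only in that one contains \<open>w\<^sub>q\<close> where the other contains \<open>w\<^bsub>q+1\<^esub>\<close>.
\<close>

lemma ferrers_exchange:
  assumes D: "ferrers_diagram D"
    and q: "1 \<le> q" "q < max1 D + max2 D + max3 D" "q \<noteq> max1 D" "q \<noteq> max1 D + max2 D"
  shows "\<exists>c\<in>D. \<exists>d\<in>D. var (Suc q) * ferrers_gen D d =
    (var q * ferrers_gen D c :: (nat, 'k::field) mpoly)"
proof -
  let ?m = "max1 D" and ?n = "max2 D"
  note [simp] = ferrers_gen_def mult_ac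
  consider "q < ?m" | "?m < q" "q < ?m + ?n" | "?m + ?n < q"
    using q by linarith
  then show ?thesis
  proof cases
    case 1
    then have "(Suc q, 1, 1) \<in> D" "(q, 1, 1) \<in> D"
      using ferrers_diagram_axes(1)[OF D] q by auto
    then show ?thesis
      by (intro bexI[of _ "(Suc q, 1, 1)"] bexI[of _ "(q, 1, 1)"]) auto
  next
    case 2
    define j where "j = q - ?m"
    have j: "q = ?m + j" and "1 \<le> j" "Suc j \<le> ?n"
      using 2 by (auto simp: j_def)
    then have "(1, Suc j, 1) \<in> D" "(1, j, 1) \<in> D"
      using ferrers_diagram_axes(2)[OF D] by auto
    then show ?thesis
      by (intro bexI[of _ "(1, Suc j, 1)"] bexI[of _ "(1, j, 1)"]) (auto simp: j)
  next
    case 3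
    define k where "k = q - (?m + ?n)"
    have k: "q = ?m + ?n + k" and "1 \<le> k" "Suc k \<le> max3 D"
      using 3 q by (auto simp: k_def)
    then have "(1, 1, Suc k) \<in> D" "(1, 1, k) \<in> D"
      using ferrers_diagram_axes(3)[OF D] by auto
    then show ?thesis
      by (intro bexI[of _ "(1, 1, Suc k)"] bexI[of _ "(1, 1, k)"]) (auto simp: k)
  qed
qed

theorem lemma6p3:
  fixes D :: "(nat \<times> nat \<times> nat) set"
    and ord :: "(nat \<times> nat \<times> nat) monom rel"
  assumes "ferrers_diagram D"
    and "monomial_order D ord"
  shows "l_exchange (max1 D + max2 D + max3 D) D
           (ferrers_gen D :: nat \<times> nat \<times> nat \<Rightarrow> (nat, 'k::field_char_0) mpoly) ord"
  unfolding l_exchange_def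
proof (intro allI impI)
  let ?m = "max1 D" and ?n = "max2 D" and ?p = "max3 D"
  let ?f = "ferrers_gen D :: nat \<times> nat \<times> nat \<Rightarrow> (nat, 'k) mpoly"
  let ?J = "toric_ideal (?m + ?n + ?p) D ?f"
  fix a b :: "(nat \<times> nat \<times> nat) monom" and q :: nat
  assume "standard_monom D ord ?J a" "standard_monom D ord ?J b"
    and deg: "monom_deg a = monom_deg b"
    and q: "1 \<le> q" "q \<le> ?m + ?n + ?p - 1"
    and eq: "\<forall>t\<in>{1..q - 1}. deg_in t (psi ?f (mono_poly a)) = deg_in t (psi ?f (mono_poly b))"
    and less: "deg_in q (psi ?f (mono_poly a)) < deg_in q (psi ?f (mono_poly b))"
  then have ab: "a \<in> monoms D" "b \<in> monoms D"
    by (simp_all add: standard_monom_def)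
  obtain i j k where "(i, j, k) \<in> D"
    using assms(1) by (auto simp: ferrers_diagram_def)
  then have pos: "1 \<le> ?m" "1 \<le> ?n"
    using ferrers_diagram_bounds[OF assms(1)] by fastforce+
  have "q \<noteq> ?m"
    using deg_in_last_of_block[of D ?f "ferrers_exp D" 1 ?m a b,
        OF ferrers_gen_eq_mono_poly ferrers_exp_x_degree[OF assms(1)] ab deg] pos eq less by auto
  moreover have "q \<noteq> ?m + ?n"
    using deg_in_last_of_block[of D ?f "ferrers_exp D" "?m + 1" "?m + ?n" a b,
        OF ferrers_gen_eq_mono_poly ferrers_exp_y_degree[OF assms(1)] ab deg] pos eq less by auto
  moreover have qN: "q < ?m + ?n + ?p"
    using q by linarith
  ultimately obtain c d where "c \<in> D" "d \<in> D" "var (Suc q) * ?f d = var q * ?f c"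
    using ferrers_exchange[OF assms(1) q(1)] by blast
  moreover have "?f d \<in> genideal (poly_ring {1..?m + ?n + ?p}) (?f ` D)"
    by (rule ferrers_gen_in_ideal) fact+
  ultimately show "\<exists>k\<in>D. \<exists>j. q < j \<and> j \<le> ?m + ?n + ?p \<and>
      (\<exists>g\<in>genideal (poly_ring {1..?m + ?n + ?p}) (?f ` D). var j * g = var q * ?f k)"
    using qN by (intro bexI[of _ c] exI[of _ "Suc q"] conjI bexI[of _ "?f d"]) auto
qed

end
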